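(* Let $\Gamma$ be an infinite cardinal such that $\Gamma^\omega=\Gamma$. Then $\ell_1(\Gamma)$, with its canonical norm $\|\cdot\|_1$, admits a point-$2$-finite lattice tiling by balls; that is, there is a discrete subgroup $\mathcal{D}$ of $\ell_1(\Gamma)$ such that $\{d+B_{\ell_1(\Gamma)}\colon d\in\mathcal{D}\}$ is a tiling of $\ell_1(\Gamma)$ and every point of $\ell_1(\Gamma)$ belongs to at most $2$ elements of this tiling.
   Context: All spaces are over the real field. $\Gamma^\omega$ denotes cardinal exponentiation (the cardinality of the set of all sequences with values in $\Gamma$). $B_{\ell_1(\Gamma)}$ is the closed unit ball of $\ell_1(\Gamma)$. A body in a normed space is a set that is the closure of its non-empty interior. A tiling of a normed space is a family of bodies that covers the space and whose members have mutually disjoint interiors. *)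

theory Defs
  imports "HOL-Analysis.Analysis"
begin

unbundle cardinal_syntax

text \<open>
  \<open>'a ell1\<close> is the real space $\ell_1(\Gamma)$, where the index set $\Gamma$ is the
  whole type \<open>'a\<close>, and the type class norm below is the canonical norm $\|\cdot\|_1$.
\<close>

typedef 'a ell1 = "{x :: 'a \<Rightarrow> real. (\<lambda>i. \<bar>x i\<bar>) summable_on UNIV}"
  morphisms coord Abs_ell1
  by (rule exI[of _ "\<lambda>_. 0"]) simp

setup_lifting type_definition_ell1

lemma abs_summable_on_iff_real:
  "(\<lambda>i. \<bar>x i\<bar>) summable_on A \<longleftrightarrow> x summable_on A" for x :: "'a \<Rightarrow> real"
  using summable_on_iff_abs_summable_on_real[of x A] by simp

instantiation ell1 :: (type) real_vector
begin

lift_definition zero_ell1 :: "'a ell1" is "\<lambda>_. 0"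
  by simp

lift_definition plus_ell1 :: "'a ell1 \<Rightarrow> 'a ell1 \<Rightarrow> 'a ell1" is "\<lambda>x y i. x i + y i"
  by (simp add: abs_summable_on_iff_real summable_on_add)

lift_definition uminus_ell1 :: "'a ell1 \<Rightarrow> 'a ell1" is "\<lambda>x i. - x i"
  by simp

lift_definition minus_ell1 :: "'a ell1 \<Rightarrow> 'a ell1 \<Rightarrow> 'a ell1" is "\<lambda>x y i. x i - y i"
  unfolding abs_summable_on_iff_real diff_conv_add_uminus
  by (intro summable_on_add summable_on_uminus[THEN iffD2])

lift_definition scaleR_ell1 :: "real \<Rightarrow> 'a ell1 \<Rightarrow> 'a ell1" is "\<lambda>c x i. c * x i"
  by (simp add: abs_summable_on_iff_real summable_on_cmult_right)

instance
  by standard (transfer; simp add: fun_eq_iff algebra_simps)+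

end

instantiation ell1 :: (type) real_normed_vector
begin

lift_definition norm_ell1 :: "'a ell1 \<Rightarrow> real" is "\<lambda>x. \<Sum>\<^sub>\<infinity>i. \<bar>x i\<bar>" .

definition sgn_ell1 :: "'a ell1 \<Rightarrow> 'a ell1"
  where "sgn_ell1 x = x /\<^sub>R norm x"

definition dist_ell1 :: "'a ell1 \<Rightarrow> 'a ell1 \<Rightarrow> real"
  where "dist_ell1 x y = norm (x - y)"

definition uniformity_ell1 :: "('a ell1 \<times> 'a ell1) filter"
  where "uniformity_ell1 = (INF e\<in>{0 <..}. principal {(x, y). dist x y < e})"

definition open_ell1 :: "'a ell1 set \<Rightarrow> bool"
  where "open_ell1 U = (\<forall>x\<in>U. \<forall>\<^sub>F (x', y) in uniformity. x' = x \<longrightarrow> y \<in> U)"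

instance
proof
  fix x y :: "'a ell1" and c :: real
  show "norm x = 0 \<longleftrightarrow> x = 0"
  proof
    assume "norm x = 0"
    then show "x = 0"
    proof transfer
      fix x :: "'a \<Rightarrow> real"
      assume "(\<lambda>i. \<bar>x i\<bar>) summable_on UNIV" and "(\<Sum>\<^sub>\<infinity>i. \<bar>x i\<bar>) = 0"
      then have "\<bar>x i\<bar> = 0" for i
        by (intro nonneg_infsum_le_0D[where A = UNIV and f = "\<lambda>i. \<bar>x i\<bar>"]) auto
      then show "x = (\<lambda>_. 0)"
        by (simp add: fun_eq_iff)
    qed
  next
    assume "x = 0"
    then show "norm x = 0"
      by (simp add: norm_ell1.rep_eq zero_ell1.rep_eq)
  qed
  show "norm (x + y) \<le> norm x + norm y"
  proof transfer
    fix x y :: "'a \<Rightarrow> real"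
    assume *: "(\<lambda>i. \<bar>x i\<bar>) summable_on UNIV" "(\<lambda>i. \<bar>y i\<bar>) summable_on UNIV"
    then have "(\<lambda>i. \<bar>x i + y i\<bar>) summable_on UNIV"
      by (simp add: abs_summable_on_iff_real summable_on_add)
    with * have "(\<Sum>\<^sub>\<infinity>i. \<bar>x i + y i\<bar>) \<le> (\<Sum>\<^sub>\<infinity>i. \<bar>x i\<bar> + \<bar>y i\<bar>)"
      by (intro infsum_mono summable_on_add) auto
    also have "\<dots> = (\<Sum>\<^sub>\<infinity>i. \<bar>x i\<bar>) + (\<Sum>\<^sub>\<infinity>i. \<bar>y i\<bar>)"
      using * by (intro infsum_add) auto
    finally show "(\<Sum>\<^sub>\<infinity>i. \<bar>x i + y i\<bar>) \<le> (\<Sum>\<^sub>\<infinity>i. \<bar>x i\<bar>) + (\<Sum>\<^sub>\<infinity>i. \<bar>y i\<bar>)" .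
  qed
  show "norm (c *\<^sub>R x) = \<bar>c\<bar> * norm x"
    by transfer (simp add: abs_mult infsum_cmult_right')
qed (simp_all add: sgn_ell1_def dist_ell1_def uniformity_ell1_def open_ell1_def)

end

definition body :: "'a::real_normed_vector set \<Rightarrow> bool"
  where "body S \<longleftrightarrow> interior S \<noteq> {} \<and> S = closure (interior S)"

definition tiling :: "'a::real_normed_vector set set \<Rightarrow> bool"
  where "tiling \<T> \<longleftrightarrow>
    (\<forall>T\<in>\<T>. body T) \<and> \<Union>\<T> = UNIV \<and> pairwise (\<lambda>S T. interior S \<inter> interior T = {}) \<T>"

definition add_subgroup :: "'a::ab_group_add set \<Rightarrow> bool"
  where "add_subgroup D \<longleftrightarrow>
    0 \<in> D \<and> (\<forall>x\<in>D. \<forall>y\<in>D. x + y \<in> D) \<and> (\<forall>x\<in>D. - x \<in> D)"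

end

theory Submission
  imports Defs
begin

text \<open>
  The lattice is built greedily along a well-order of $\ell_1(\Gamma)$ whose initial segments all
  have cardinality below $\Gamma$; such an order exists because $\Gamma^\omega = \Gamma$ gives
  $|\ell_1(\Gamma)| \le \Gamma$. Each $x$ is assigned a coordinate \<open>\<gamma> x\<close> outside the
  supports of all \<open>y \<le> x\<close> and different from all earlier \<open>\<gamma> y\<close>. If $x$
  is not yet covered by the balls around the group generated so far, the generator
  $x + e_{\gamma x}$, at distance $1$ from $x$, is added. For $u$ in the old group and $n \ne 0$,
  \[ \|n (x + e_{\gamma x}) + u\|_1 = |n| + \|n x + u\|_1, \]
  which exceeds $2$ if $n = \pm 1$ (as $x$ was uncovered) and is at least $|n| \ge 2$ otherwise.
  So nonzero elements of the group have norm at least $2$, and norm exactly $2$ only if they are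
  $\pm 2 e_\gamma$. Three balls with a common point would give three elements of this form with
  sum zero, which is impossible.
\<close>

section \<open>Norms of vectors with a fresh coordinate\<close>

lift_definition single_ell1 :: "'a \<Rightarrow> real \<Rightarrow> 'a ell1" is "\<lambda>i t j. if j = i then t else 0"
proof -
  fix i :: 'a and t :: real
  have "(\<lambda>j. \<bar>if j = i then t else 0\<bar>) summable_on {i}"
    by simp
  then show "(\<lambda>j. \<bar>if j = i then t else 0\<bar>) summable_on UNIV"
    by (subst summable_on_cong_neutral[where T = "{i}"]) auto
qed

lemma ell1_eqI: "(\<And>i. coord x i = coord y i) \<Longrightarrow> x = y"
  by (metis coord_inject ext)

lemma scaleR_single_ell1: "c *\<^sub>R single_ell1 i t = single_ell1 i (c * t)"
  by (rule ell1_eqI) (simp add: scaleR_ell1.rep_eq single_ell1.rep_eq)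

text \<open>The two summands have disjoint supports, and the l1 norm is additive over the splitting
  of the index set into \<open>i\<close> and its complement.\<close>

lemma norm_add_single_ell1:
  assumes "coord z i = 0"
  shows "norm (z + single_ell1 i t) = norm z + \<bar>t\<bar>"
proof -
  have split: "norm x = \<bar>coord x i\<bar> + (\<Sum>\<^sub>\<infinity>j\<in>-{i}. \<bar>coord x j\<bar>)"
    for x :: "'a ell1"
  proof -
    have "(\<lambda>j. \<bar>coord x j\<bar>) summable_on -{i}"
      using coord[of x] by (auto intro: summable_on_subset_banach)
    then have "infsum (\<lambda>j. \<bar>coord x j\<bar>) (insert i (-{i})) = \<bar>coord x i\<bar> + (\<Sum>\<^sub>\<infinity>j\<in>-{i}. \<bar>coord x j\<bar>)"
      by (subst infsum_insert) auto
    moreover have "insert i (-{i}) = UNIV"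
      by auto
    ultimately show ?thesis
      by (simp add: norm_ell1.rep_eq)
  qed
  have "(\<Sum>\<^sub>\<infinity>j\<in>-{i}. \<bar>coord (z + single_ell1 i t) j\<bar>) = (\<Sum>\<^sub>\<infinity>j\<in>-{i}. \<bar>coord z j\<bar>)"
    by (rule infsum_cong) (auto simp: plus_ell1.rep_eq single_ell1.rep_eq)
  with assms show ?thesis
    unfolding split[of z] split[of "z + single_ell1 i t"]
    by (simp add: plus_ell1.rep_eq single_ell1.rep_eq)
qed

lemma norm_single_ell1 [simp]: "norm (single_ell1 i t) = \<bar>t\<bar>"
  using norm_add_single_ell1[of 0 i t] by (simp add: zero_ell1.rep_eq)

lemma norm_single_add_single_ell1:
  "norm (single_ell1 i s + single_ell1 j t) = (if i = j then \<bar>s + t\<bar> else \<bar>s\<bar> + \<bar>t\<bar>)"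
proof (cases "i = j")
  case True
  then have "single_ell1 i s + single_ell1 j t = single_ell1 i (s + t)"
    by (intro ell1_eqI) (simp add: plus_ell1.rep_eq single_ell1.rep_eq)
  with True show ?thesis
    by simp
next
  case False
  then show ?thesis
    by (simp add: norm_add_single_ell1 single_ell1.rep_eq)
qed

section \<open>The greedy lattice\<close>

text \<open>Over the integers, the span of a set is the additive subgroup it generates, so the
  general theory of spans applies to lattices.\<close>

interpretation zmod: module "\<lambda>n x. of_int n *\<^sub>R x :: 'b::real_vector"
  by unfold_locales (auto simp: algebra_simps)

lemma finite_total_trans_max:
  assumes "finite F" "F \<noteq> {}" "trans R" "total R"
  shows "\<exists>m\<in>F. \<forall>y\<in>F. y = m \<or> (y, m) \<in> R"
  using assms(1,2)
proof (induction F rule: finite_ne_induct)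
  case (insert x F)
  then obtain m where "m \<in> F" "\<forall>y\<in>F. y = m \<or> (y, m) \<in> R"
    by blast
  moreover have "x = m \<or> (x, m) \<in> R \<or> (m, x) \<in> R"
    using \<open>total R\<close> by (auto simp: total_on_def)
  ultimately show ?case
    using \<open>trans R\<close> by (auto dest: transD)
qed simp

text \<open>Collects what the transfinite construction delivers: \<open>R\<close> is the strict
  order, \<open>below x\<close> the group generated before stage \<open>x\<close>, and
  \<open>S\<close> the set of points still uncovered at their own stage.\<close>

locale greedy_lattice =
  fixes R :: "('a ell1 \<times> 'a ell1) set" and \<gamma> :: "'a ell1 \<Rightarrow> 'a" and S :: "'a ell1 set"
    and gen :: "'a ell1 \<Rightarrow> 'a ell1" and below :: "'a ell1 \<Rightarrow> 'a ell1 set"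
  assumes trans_R: "trans R" and total_R: "total R"
    and fresh_self: "coord x (\<gamma> x) = 0"
    and fresh_below: "(y, x) \<in> R \<Longrightarrow> coord y (\<gamma> x) = 0"
    and \<gamma>_neq: "(y, x) \<in> R \<Longrightarrow> \<gamma> y \<noteq> \<gamma> x"
    and gen_def: "gen x = x + single_ell1 (\<gamma> x) 1"
    and below_def: "below x = zmod.span (gen ` {y \<in> S. (y, x) \<in> R})"
    and S_iff: "x \<in> S \<longleftrightarrow> (\<forall>u\<in>below x. norm (x - u) > 1)"
begin

definition lattice :: "'a ell1 set"
  where "lattice = zmod.span (gen ` S)"

lemma below_subset_lattice: "below x \<subseteq> lattice"
  unfolding lattice_def below_def by (rule zmod.span_mono) auto

text \<open>An earlier generator is \<open>y\<close> plus a unit vector at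
  \<open>\<gamma> y\<close>; the first part vanishes at \<open>\<gamma> x\<close> by freshness, the
  second because the labels differ. Integer combinations inherit this.\<close>

lemma coord_below_fresh:
  assumes "u \<in> below x"
  shows "coord u (\<gamma> x) = 0"
  using assms unfolding below_def
proof (induction rule: zmod.span_induct_alt)
  case base
  then show ?case
    by (simp add: zero_ell1.rep_eq)
next
  case (step c g u)
  then show ?case
    using \<gamma>_neq[of _ x, symmetric] by (auto simp: gen_def plus_ell1.rep_eq scaleR_ell1.rep_eq single_ell1.rep_eq fresh_below)
qed

lemma norm_scale_gen_add:
  assumes "u \<in> below x"
  shows "norm (of_int n *\<^sub>R gen x + u) = \<bar>of_int n\<bar> + norm (of_int n *\<^sub>R x + u)"
proof -
  have "of_int n *\<^sub>R gen x + u = (of_int n *\<^sub>R x + u) + single_ell1 (\<gamma> x) (of_int n)"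
    by (simp add: gen_def scaleR_add_right scaleR_single_ell1)
  moreover have "coord (of_int n *\<^sub>R x + u) (\<gamma> x) = 0"
    using assms by (simp add: plus_ell1.rep_eq scaleR_ell1.rep_eq fresh_self coord_below_fresh)
  ultimately show ?thesis
    by (metis add.commute norm_add_single_ell1)
qed

text \<open>Only finitely many generators occur in \<open>v\<close>; the last one in the order with
  nonzero coefficient is split off, and the remainder uses earlier generators only.\<close>

lemma lattice_top_generator:
  assumes "v \<in> lattice" "v \<noteq> 0"
  obtains x n u where "x \<in> S" "n \<noteq> 0" "u \<in> below x" "v = of_int n *\<^sub>R gen x + u"
proof -
  obtain t where t: "finite t" "t \<subseteq> gen ` S" "v \<in> zmod.span t"
    using assms(1) unfolding lattice_def zmod.span_explicit by blast
  then obtain F where F: "finite F" "F \<subseteq> S" "t = gen ` F"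
    by (meson finite_subset_image)
  \<comment> \<open>Induction on the finite index set: if the maximum \<open>m\<close> can be given
    coefficient 0, it is discarded. As \<open>v\<close> is nonzero, the set never becomes
    empty.\<close>
  have "\<exists>x\<in>F. \<exists>n. n \<noteq> 0 \<and> v - of_int n *\<^sub>R gen x \<in> zmod.span (gen ` {y \<in> F. (y, x) \<in> R})"
    using F(1) t(3)[unfolded F(3)]
  proof (induction F rule: finite_psubset_induct)
    case (psubset F)
    have "F \<noteq> {}"
      using psubset.prems \<open>v \<noteq> 0\<close> by auto
    then obtain m where m: "m \<in> F" "\<forall>y\<in>F. y = m \<or> (y, m) \<in> R"
      using finite_total_trans_max[OF psubset.hyps _ trans_R total_R] by blast
    have "F = insert m (F - {m})"
      using m(1) by auto
    then have "v \<in> zmod.span (insert (gen m) (gen ` (F - {m})))"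
      using psubset.prems by (metis image_insert)
    then obtain k where k: "v - of_int k *\<^sub>R gen m \<in> zmod.span (gen ` (F - {m}))"
      unfolding zmod.span_insert by blast
    show ?case
    proof (cases "k = 0")
      case False
      have "gen ` (F - {m}) \<subseteq> gen ` {y \<in> F. (y, m) \<in> R}"
        using m(2) by auto
      then show ?thesis
        using k m(1) False zmod.span_mono by blast
    next
      case True
      then obtain x n where "x \<in> F - {m}" "n \<noteq> 0"
        "v - of_int n *\<^sub>R gen x \<in> zmod.span (gen ` {y \<in> F - {m}. (y, x) \<in> R})"
        using psubset.IH[of "F - {m}"] k m(1) by auto
      moreover have "gen ` {y \<in> F - {m}. (y, x) \<in> R} \<subseteq> gen ` {y \<in> F. (y, x) \<in> R}"
        by auto
      ultimately show ?thesis
        using zmod.span_mono by blast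
    qed
  qed
  then obtain x n where "x \<in> F" "n \<noteq> 0"
    and u: "v - of_int n *\<^sub>R gen x \<in> zmod.span (gen ` {y \<in> F. (y, x) \<in> R})"
    by blast
  moreover have "gen ` {y \<in> F. (y, x) \<in> R} \<subseteq> gen ` {y \<in> S. (y, x) \<in> R}"
    using F(2) by auto
  then have "v - of_int n *\<^sub>R gen x \<in> below x"
    using u zmod.span_mono unfolding below_def by blast
  ultimately show ?thesis
    using that[of x n "v - of_int n *\<^sub>R gen x"] F(2) by auto
qed

lemma lattice_norm_cases:
  assumes "v \<in> lattice" "v \<noteq> 0"
  obtains "norm v > 2" | i t where "v = single_ell1 i t" "\<bar>t\<bar> = 2"
proof -
  obtain x n u where x: "x \<in> S" "n \<noteq> 0" "u \<in> below x" and v: "v = of_int n *\<^sub>R gen x + u"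
    using lattice_top_generator[OF assms] by blast
  have nv: "norm v = \<bar>of_int n\<bar> + norm (of_int n *\<^sub>R x + u)"
    using v norm_scale_gen_add x(3) by simp
  consider "\<bar>n\<bar> = 1" | "\<bar>n\<bar> = 2" | "\<bar>n\<bar> > 2"
    using x(2) by linarith
  then show ?thesis
  proof cases
    case 1
    \<comment> \<open>Since \<open>n\<close> squared is 1, \<open>n x + u\<close> equals
      \<open>n (x + n u)\<close>, whose norm is the distance from \<open>x\<close> to
      \<open>- n u\<close>, an element of the group that failed to cover \<open>x\<close>.\<close>
    have "- (of_int n *\<^sub>R u) \<in> below x"
      using x(3) unfolding below_def by (intro zmod.span_neg zmod.span_scale)
    then have "norm (x + of_int n *\<^sub>R u) > 1"
      using x(1) S_iff[of x] by fastforce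
    moreover have "of_int n *\<^sub>R (of_int n *\<^sub>R x + u) = x + of_int n *\<^sub>R u"
      using 1 by (auto simp: scaleR_add_right abs_if split: if_splits)
    then have "norm (of_int n *\<^sub>R x + u) = norm (x + of_int n *\<^sub>R u)"
      using 1 by (metis mult_1 norm_scaleR of_int_1 of_int_abs)
    ultimately have "norm v > 2"
      using nv 1 by (metis add_strict_left_mono of_int_1 of_int_abs one_add_one)
    then show ?thesis
      using that by blast
  next
    case 2
    then have n2: "\<bar>real_of_int n\<bar> = 2"
      by linarith
    show ?thesis
    proof (cases "of_int n *\<^sub>R x + u = 0")
      case True
      then have "v = single_ell1 (\<gamma> x) (of_int n)"
        unfolding v gen_def
        by (metis add.commute add.left_neutral add.left_commute mult.right_neutral scaleR_add_right scaleR_single_ell1)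
      then show ?thesis
        using that n2 by blast
    next
      case False
      then have "norm v > 2"
        using nv n2 by simp
      then show ?thesis
        using that by blast
    qed
  next
    case 3
    then have "\<bar>real_of_int n\<bar> > 2"
      by linarith
    then have "norm v > 2"
      using nv norm_ge_zero[of "of_int n *\<^sub>R x + u"] by linarith
    then show ?thesis
      using that by blast
  qed
qed

lemma norm_lattice_ge: "v \<in> lattice \<Longrightarrow> v \<noteq> 0 \<Longrightarrow> norm v \<ge> 2"
  by (erule lattice_norm_cases) auto

lemma lattice_diff: "v \<in> lattice \<Longrightarrow> w \<in> lattice \<Longrightarrow> v - w \<in> lattice"
  unfolding lattice_def by (rule zmod.span_diff)

lemma dist_lattice_ge: "v \<in> lattice \<Longrightarrow> w \<in> lattice \<Longrightarrow> v \<noteq> w \<Longrightarrow> dist v w \<ge> 2"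
  using norm_lattice_ge[of "v - w"] by (simp add: dist_norm lattice_diff)

lemma add_subgroup_lattice: "add_subgroup lattice"
  unfolding add_subgroup_def lattice_def
  by (simp add: zmod.span_zero zmod.span_add zmod.span_neg)

lemma discrete_lattice: "discrete lattice"
proof (rule uniform_discrete_imp_discrete)
  show "uniform_discrete lattice"
    unfolding uniform_discrete_def using dist_lattice_ge by (intro exI[of _ 2]) force
qed

text \<open>A point left uncovered by earlier balls lies on the boundary of the ball around its own
  generator, at distance exactly 1; the tiles are closed.\<close>

lemma lattice_covers: "\<exists>d\<in>lattice. x \<in> cball d 1"
proof (cases "x \<in> S")
  case True
  then have "gen x \<in> lattice"
    unfolding lattice_def by (intro zmod.span_base) auto
  moreover have "dist (gen x) x = 1"
    by (simp add: gen_def dist_norm)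
  ultimately show ?thesis
    by force
next
  case False
  then obtain u where "u \<in> below x" "norm (x - u) \<le> 1"
    using S_iff[of x] by force
  then show ?thesis
    using below_subset_lattice by (force simp: dist_norm norm_minus_commute)
qed

lemma lattice_no_three:
  assumes d: "d1 \<in> lattice" "d2 \<in> lattice" "d3 \<in> lattice"
    and neq: "d1 \<noteq> d2" "d2 \<noteq> d3" "d1 \<noteq> d3"
    and x: "x \<in> cball d1 1" "x \<in> cball d2 1" "x \<in> cball d3 1"
  shows False
proof -
  have *: "\<exists>i t. d - e = single_ell1 i t \<and> \<bar>t\<bar> = 2"
    if de: "d \<in> lattice" "e \<in> lattice" "d \<noteq> e" "x \<in> cball d 1" "x \<in> cball e 1" for d e
  proof -
    have "norm (d - e) \<le> 2"
      using that dist_triangle[of d e x] by (simp add: dist_norm dist_commute norm_minus_commute)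
    then show ?thesis
      using lattice_norm_cases[of "d - e"] that lattice_diff by (metis linorder_not_less right_minus_eq)
  qed
  obtain i s where 1: "d1 - d2 = single_ell1 i s" "\<bar>s\<bar> = 2"
    using * assms by meson
  obtain j t where 2: "d2 - d3 = single_ell1 j t" "\<bar>t\<bar> = 2"
    using * assms by meson
  obtain k r where 3: "d1 - d3 = single_ell1 k r" "\<bar>r\<bar> = 2"
    using * assms by meson
  have "single_ell1 i s + single_ell1 j t = single_ell1 k r"
    using 1 2 3 by (metis diff_add_cancel add_diff_eq)
  then have "norm (single_ell1 i s + single_ell1 j t) = 2"
    using 3(2) by simp
  then show False
    \<comment> \<open>The sum has norm 4 if \<open>i\<close> and \<open>j\<close> differ, and norm 0
      or 4 if they agree, but never 2.\<close>
    using 1(2) 2(2) by (auto simp: norm_single_add_single_ell1 split: if_splits)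
qed

end

section \<open>Closed balls as tiles of a normed space\<close>

lemma body_cball:
  fixes d :: "'b::real_normed_vector"
  assumes "e > 0"
  shows "body (cball d e)"
proof -
  have sub: "ball d e \<subseteq> interior (cball d e)"
    by (simp add: interior_maximal)
  have "closure (ball d e) \<subseteq> closure (interior (cball d e))"
    by (rule closure_mono[OF sub])
  moreover have "closure (interior (cball d e)) \<subseteq> cball d e"
    by (simp add: closure_minimal interior_subset)
  ultimately show ?thesis
    using sub assms unfolding body_def by (auto simp: closure_ball)
qed

lemma disjoint_interior_cball:
  fixes c d :: "'b::real_normed_vector"
  assumes "dist c d \<ge> 2"
  shows "interior (cball c 1) \<inter> interior (cball d 1) = {}"
proof -
  have "interior (cball c 1) \<inter> ball d 1 = {}"
  proof -
    have False if "z \<in> interior (cball c 1)" "z \<in> ball d 1" for z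
    proof -
      have "dist c z \<le> 1" "dist d z < 1"
        using that interior_subset[of "cball c 1"] by auto
      then show False
        using assms dist_triangle2[of c d z] by linarith
    qed
    then show ?thesis
      by auto
  qed
  \<comment> \<open>An open set that misses a set also misses its closure, and the closure of the
    open ball is the closed ball.\<close>
  then have "interior (cball c 1) \<inter> closure (ball d 1) = {}"
    by (metis open_Int_closure_eq_empty open_interior)
  then show ?thesis
    using interior_subset[of "cball d 1"] by (auto simp: closure_ball)
qed

section \<open>Choice of fresh coordinates\<close>

text \<open>A real is determined by its Dedekind cut, and the rationals are countable.\<close>

lemma inj_real_to_nat_set: "\<exists>f :: real \<Rightarrow> nat set. inj f"
proof
  have "inj (\<lambda>x::real. {q :: rat. of_rat q < x})"
  proof (rule injI)
    fix x y :: real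
    assume eq: "{q :: rat. of_rat q < x} = {q. of_rat q < y}"
    show "x = y"
      using of_rat_dense[of x y] of_rat_dense[of y x] eq
      by (metis (mono_tags, lifting) linorder_neqE_linordered_idom mem_Collect_eq not_less_iff_gr_or_eq)
  qed
  moreover have "inj (image (to_nat :: rat \<Rightarrow> nat))"
    by (intro injI) (simp add: inj_image_eq_iff)
  ultimately show "inj (image to_nat \<circ> (\<lambda>x::real. {q :: rat. of_rat q < x}))"
    by (rule inj_compose[rotated])
qed

lemma countable_support: "countable {i. coord x i \<noteq> 0}"
proof -
  have "(\<lambda>i. norm (coord x i)) summable_on UNIV"
    using coord[of x] by simp
  from abs_summable_countable[OF this] show ?thesis
    by simp
qed

text \<open>A vector is recovered from the part of its graph over its countable support, and that
  set is the range of its enumeration.\<close>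

lemma inj_ell1_to_seq: "\<exists>f :: 'a ell1 \<Rightarrow> nat \<Rightarrow> 'a \<times> real. inj f"
proof
  \<comment> \<open>The dummy pair makes the set nonempty, so it can be enumerated; having value 0,
    it is not confused with an entry of the support.\<close>
  define C where "C x = insert (undefined, 0) ((\<lambda>i. (i, coord x i)) ` {i. coord x i \<noteq> 0})"
    for x :: "'a ell1"
  have range_C: "range (from_nat_into (C x)) = C x" for x
    using countable_support[of x] by (intro range_from_nat_into) (auto simp: C_def)
  show "inj (\<lambda>x. from_nat_into (C x))"
  proof (rule injI)
    fix x y :: "'a ell1"
    assume "from_nat_into (C x) = from_nat_into (C y)"
    then have "C x = C y"
      by (metis range_C)
    then have "(i, t) \<in> C x \<longleftrightarrow> (i, t) \<in> C y" for i t
      by simp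
    then have "t \<noteq> 0 \<Longrightarrow> coord x i = t \<longleftrightarrow> coord y i = t" for i t
      by (auto simp: C_def image_iff)
    then show "x = y"
      by (intro ell1_eqI) metis
  qed
qed

lemma inj_seq_if_cexp:
  assumes "|UNIV :: 'a set| ^c natLeq =o |UNIV :: 'a set|"
  shows "\<exists>f :: (nat \<Rightarrow> 'a) \<Rightarrow> 'a. inj f"
proof -
  have "|Func (UNIV :: nat set) (UNIV :: 'a set)| \<le>o |UNIV :: 'a set|"
    using assms unfolding cexp_def by (simp add: Field_natLeq Field_card_of ordIso_imp_ordLeq)
  moreover have "Func (UNIV :: nat set) (UNIV :: 'a set) = UNIV"
    by (auto simp: Func_def)
  ultimately show ?thesis
    by (simp flip: card_of_ordLeq)
qed

lemma inj_nat_set_if_inj_seq: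
  fixes f :: "(nat \<Rightarrow> 'a) \<Rightarrow> 'a"
  assumes "inj f" "infinite (UNIV :: 'a set)"
  shows "\<exists>h :: nat set \<Rightarrow> 'a. inj h"
proof -
  obtain a b :: 'a where "a \<noteq> b"
    using assms(2) by (metis UNIV_eq_I finite.simps insertCI)
  then have "inj (\<lambda>A n. if n \<in> A then a else b)"
    by (intro injI) (metis subsetI subset_antisym)
  then show ?thesis
    using inj_compose[OF assms(1)] by blast
qed

text \<open>Sequences of pairs in Gamma times the reals are coded as sequences in Gamma, since the
  reals embed in Gamma through sets of naturals and Gamma absorbs its square; \<open>f\<close> then
  codes sequences by elements.\<close>

lemma inj_ell1_if_inj_seq:
  fixes f :: "(nat \<Rightarrow> 'a) \<Rightarrow> 'a"
  assumes "inj f" "infinite (UNIV :: 'a set)"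
  shows "\<exists>h :: 'a ell1 \<Rightarrow> 'a. inj h"
proof -
  obtain h1 :: "real \<Rightarrow> nat set" and h2 :: "nat set \<Rightarrow> 'a" where h: "inj h1" "inj h2"
    using inj_real_to_nat_set inj_nat_set_if_inj_seq[OF assms] by blast
  have "|UNIV \<times> UNIV :: ('a \<times> 'a) set| \<le>o |UNIV :: 'a set|"
    using card_of_Times_same_infinite[OF assms(2)] by (rule ordIso_imp_ordLeq)
  then obtain p :: "'a \<times> 'a \<Rightarrow> 'a" where p: "inj p"
    by (auto simp flip: card_of_ordLeq)
  obtain s :: "'a ell1 \<Rightarrow> nat \<Rightarrow> 'a \<times> real" where s: "inj s"
    using inj_ell1_to_seq by blast
  have q: "inj (\<lambda>(i, t). p (i, h2 (h1 t)))"
    by (auto intro!: injI dest!: injD[OF p] injD[OF h(1)] injD[OF h(2)])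
  have "inj (\<lambda>x. f (\<lambda>n. (\<lambda>(i, t). p (i, h2 (h1 t))) (s x n)))"
  proof (rule injI)
    fix x y
    assume "f (\<lambda>n. (\<lambda>(i, t). p (i, h2 (h1 t))) (s x n)) = f (\<lambda>n. (\<lambda>(i, t). p (i, h2 (h1 t))) (s y n))"
    then have "(\<lambda>n. (\<lambda>(i, t). p (i, h2 (h1 t))) (s x n)) = (\<lambda>n. (\<lambda>(i, t). p (i, h2 (h1 t))) (s y n))"
      using assms(1) by (rule injD[rotated])
    then have "s x = s y"
      using q by (meson ext fun_cong injD)
    then show "x = y"
      using s by (rule injD[rotated])
  qed
  then show ?thesis
    by blast
qed

text \<open>The product embeds in the square of the disjoint sum. If that sum is infinite, it is
  equipotent with its square and stays below \<open>C\<close>.\<close>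

lemma card_of_Times_ordLess:
  assumes inf: "infinite C" and A: "|A| <o |C|" and B: "|B| <o |C|"
  shows "|A \<times> B| <o |C|"
proof (cases "finite (A <+> B)")
  case True
  then have "finite (A \<times> B)"
    by simp
  then show ?thesis
    by (intro finite_ordLess_infinite[OF card_of_Well_order card_of_Well_order])
      (simp_all add: Field_card_of inf)
next
  case False
  have "|A \<times> B| \<le>o |(A <+> B) \<times> (A <+> B)|"
    by (subst card_of_ordLeq[symmetric]) (auto intro!: exI[of _ "map_prod Inl Inr"] simp: inj_on_def)
  then have "|A \<times> B| \<le>o |A <+> B|"
    using card_of_Times_same_infinite[OF False] by (rule ordLeq_ordIso_trans)
  then show ?thesis
    using card_of_Plus_ordLess_infinite[OF inf A B] by (rule ordLeq_ordLess_trans)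
qed

text \<open>Forbidden coordinates are the used labels and countably many support points for each
  vector of \<open>A\<close> and for \<open>x\<close>; together they number fewer than
  Gamma.\<close>

lemma ex_fresh_coordinate:
  fixes A :: "'a ell1 set" and \<gamma> :: "'a ell1 \<Rightarrow> 'a"
  assumes inf: "infinite (UNIV :: 'a set)" and nat: "|UNIV :: nat set| <o |UNIV :: 'a set|"
    and A: "|A| <o |UNIV :: 'a set|"
  shows "\<exists>i. coord x i = 0 \<and> (\<forall>y\<in>A. coord y i = 0 \<and> \<gamma> y \<noteq> i)"
proof -
  \<comment> \<open>For an empty support the enumeration yields an arbitrary coordinate; this only
    enlarges the forbidden set.\<close>
  let ?enum = "\<lambda>(y, n). from_nat_into {i. coord y i \<noteq> 0} n"
  let ?bad = "\<gamma> ` A \<union> ?enum ` ((A \<union> {x}) \<times> UNIV)"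
  have "|{x}| <o |UNIV :: 'a set|"
    by (rule finite_ordLess_infinite[OF card_of_Well_order card_of_Well_order]) (simp_all add: Field_card_of inf)
  then have "|(A \<union> {x}) \<times> (UNIV :: nat set)| <o |UNIV :: 'a set|"
    using card_of_Times_ordLess[OF inf _ nat] card_of_Un_ordLess_infinite[OF inf A] by blast
  then have "|?bad| <o |UNIV :: 'a set|"
    using A by (intro card_of_Un_ordLess_infinite[OF inf] ordLeq_ordLess_trans[OF card_of_image])
  then have "?bad \<noteq> UNIV"
    using ordLess_irreflexive by metis
  then obtain i where i: "i \<notin> ?bad"
    by blast
  have "coord y i = 0" if "y \<in> A \<union> {x}" for y
  proof (rule ccontr)
    assume "coord y i \<noteq> 0"
    then obtain n where "i = from_nat_into {i. coord y i \<noteq> 0} n"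
      using from_nat_into_surj[OF countable_support[of y], of i] by blast
    then have "i \<in> ?bad"
      using that by (auto intro!: image_eqI[where x = "(y, n)"])
    with i show False
      by blast
  qed
  with i show ?thesis
    by blast
qed

section \<open>The two recursions along the well-order\<close>

lemma ex_greedy_lattice:
  assumes inf: "infinite (UNIV :: 'a set)"
    and cexp: "|UNIV :: 'a set| ^c natLeq =o |UNIV :: 'a set|"
  shows "\<exists>(R :: 'a ell1 rel) \<gamma> S gen below. greedy_lattice R \<gamma> S gen below"
proof -
  obtain f :: "(nat \<Rightarrow> 'a) \<Rightarrow> 'a" where f: "inj f"
    using inj_seq_if_cexp[OF cexp] by blast
  obtain h :: "nat set \<Rightarrow> 'a" where "inj h"
    using inj_nat_set_if_inj_seq[OF f inf] by blast
  then have "|UNIV :: nat set set| \<le>o |UNIV :: 'a set|"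
    by (auto simp flip: card_of_ordLeq)
  \<comment> \<open>Cantor's theorem makes Gamma uncountable.\<close>
  then have nat: "|UNIV :: nat set| <o |UNIV :: 'a set|"
    using card_of_Pow[of "UNIV :: nat set"] ordLess_ordLeq_trans by (simp add: Pow_UNIV)
  obtain k :: "'a ell1 \<Rightarrow> 'a" where "inj k"
    using inj_ell1_if_inj_seq[OF f inf] by blast
  then have ell1: "|UNIV :: 'a ell1 set| \<le>o |UNIV :: 'a set|"
    by (auto simp flip: card_of_ordLeq)
  \<comment> \<open>\<open>r\<close> is a cardinal order, so each proper initial segment is strictly
    smaller than the whole space, hence smaller than Gamma.\<close>
  define r where "r = |UNIV :: 'a ell1 set|"
  define R where "R = r - Id"
  have wo: "Well_order r" and field: "Field r = UNIV"
    unfolding r_def by (rule card_of_Well_order, rule Field_card_of)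
  have wf: "wf R"
    using wo unfolding R_def well_order_on_def by blast
  have trans: "trans R"
    using wo unfolding R_def well_order_on_def linear_order_on_def partial_order_on_def preorder_on_def
    by (blast intro: trans_diff_Id)
  have total: "total R"
    using wo unfolding R_def well_order_on_def linear_order_on_def field
    by (auto simp: total_on_def)
  have segment: "|{y. (y, x) \<in> R}| <o |UNIV :: 'a set|" for x
  proof -
    have "{y. (y, x) \<in> R} = underS r x"
      by (auto simp: R_def underS_def)
    moreover have "|underS r x| <o r"
      unfolding r_def by (rule card_of_underS[OF card_of_Card_order]) (simp add: Field_card_of)
    ultimately show ?thesis
      using ell1 ordLess_ordLeq_trans unfolding r_def by metis
  qed
  have "\<exists>\<gamma> :: 'a ell1 \<Rightarrow> 'a. \<forall>x. coord x (\<gamma> x) = 0 \<and>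
      (\<forall>y\<in>{y. (y, x) \<in> R}. coord y (\<gamma> x) = 0 \<and> \<gamma> y \<noteq> \<gamma> x)"
    by (rule dependent_wf_choice[OF wf]) (auto intro!: ex_fresh_coordinate[OF inf nat segment, simplified])
  then obtain \<gamma> :: "'a ell1 \<Rightarrow> 'a" where
    \<gamma>: "\<And>x. coord x (\<gamma> x) = 0" "\<And>x y. (y, x) \<in> R \<Longrightarrow> coord y (\<gamma> x) = 0 \<and> \<gamma> y \<noteq> \<gamma> x"
    by blast
  define gen where "gen x = x + single_ell1 (\<gamma> x) 1" for x
  \<comment> \<open>Second recursion, now with truth values: whether \<open>x\<close> contributes a
    generator depends only on the decisions at earlier points.\<close>
  have "\<exists>p. \<forall>x. p x \<longleftrightarrow> (\<forall>u\<in>zmod.span (gen ` {y. p y \<and> (y, x) \<in> R}). norm (x - u) > 1)"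
  proof (rule dependent_wf_choice[OF wf])
    fix p q :: "'a ell1 \<Rightarrow> bool" and x b
    assume "\<And>z. (z, x) \<in> R \<Longrightarrow> p z = q z"
    then have "{y. p y \<and> (y, x) \<in> R} = {y. q y \<and> (y, x) \<in> R}"
      by blast
    then show "(b \<longleftrightarrow> (\<forall>u\<in>zmod.span (gen ` {y. p y \<and> (y, x) \<in> R}). norm (x - u) > 1)) \<longleftrightarrow>
        (b \<longleftrightarrow> (\<forall>u\<in>zmod.span (gen ` {y. q y \<and> (y, x) \<in> R}). norm (x - u) > 1))"
      by simp
  qed blast
  then obtain p where
    p: "\<And>x. p x \<longleftrightarrow> (\<forall>u\<in>zmod.span (gen ` {y. p y \<and> (y, x) \<in> R}). norm (x - u) > 1)"
    by blast
  have "greedy_lattice R \<gamma> (Collect p) gen (\<lambda>x. zmod.span (gen ` {y \<in> Collect p. (y, x) \<in> R}))"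
  proof
    show "x \<in> Collect p \<longleftrightarrow>
        (\<forall>u\<in>zmod.span (gen ` {y \<in> Collect p. (y, x) \<in> R}). norm (x - u) > 1)" for x
      unfolding mem_Collect_eq by (rule p)
  qed (simp_all add: trans total \<gamma> gen_def)
  then show ?thesis
    by (intro exI)
qed

theorem theorem2:
  assumes "infinite (UNIV :: 'a set)"
    and "|UNIV :: 'a set| ^c natLeq =o |UNIV :: 'a set|"
  shows "\<exists>D :: 'a ell1 set. add_subgroup D \<and> discrete D \<and>
    tiling ((\<lambda>d. (+) d ` cball 0 1) ` D) \<and>
    (\<forall>x. finite {T \<in> (\<lambda>d. (+) d ` cball 0 1) ` D. x \<in> T} \<and>
         card {T \<in> (\<lambda>d. (+) d ` cball 0 1) ` D. x \<in> T} \<le> 2)"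
proof -
  obtain R :: "'a ell1 rel" and \<gamma> S gen below where "greedy_lattice R \<gamma> S gen below"
    using ex_greedy_lattice[OF assms] by blast
  then interpret greedy_lattice R \<gamma> S gen below .
  have translate: "(\<lambda>d :: 'a ell1. (+) d ` cball 0 1) = (\<lambda>d. cball d 1)"
    by (simp flip: cball_translation)
  have "tiling ((\<lambda>d. cball d 1) ` lattice)"
    unfolding tiling_def
  proof (intro conjI ballI)
    show "body T" if "T \<in> (\<lambda>d. cball d 1) ` lattice" for T
      using that body_cball[of 1] by auto
    show "(\<Union>d\<in>lattice. cball d 1) = UNIV"
      using lattice_covers by blast
    show "pairwise (\<lambda>S T. interior S \<inter> interior T = {}) ((\<lambda>d. cball d 1) ` lattice)"
      unfolding pairwise_def using disjoint_interior_cball dist_lattice_ge by fastforce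
  qed
  moreover have "finite {T \<in> (\<lambda>d. cball d 1) ` lattice. x \<in> T} \<and>
      card {T \<in> (\<lambda>d. cball d 1) ` lattice. x \<in> T} \<le> 2" for x
  proof -
    \<comment> \<open>Centres are counted instead of tiles: the tiles through \<open>x\<close> are
      the image of \<open>N\<close>, so there are at most as many.\<close>
    define N where "N = {d \<in> lattice. x \<in> cball d 1}"
    have three: "a = b \<or> b = c \<or> a = c" if "a \<in> N" "b \<in> N" "c \<in> N" for a b c
      using that lattice_no_three[of a b c x] unfolding N_def by blast
    obtain d e where "N \<subseteq> {d, e}"
    proof (cases "\<exists>d\<in>N. \<exists>e\<in>N. d \<noteq> e")
      case True
      then obtain d e where "d \<in> N" "e \<in> N" "d \<noteq> e"
        by blast
      then have "N \<subseteq> {d, e}"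
        using three by blast
      then show ?thesis
        using that by blast
    qed (use that in blast)
    then have N: "finite N" "card N \<le> 2"
      using card_mono[of "{d, e}" N] card_insert_le_m1[of 2 "{e}" d] by (auto intro: finite_subset)
    have "{T \<in> (\<lambda>d. cball d 1) ` lattice. x \<in> T} = (\<lambda>d. cball d 1) ` N"
      by (auto simp: N_def)
    then show ?thesis
      using N card_image_le[OF N(1), of "\<lambda>d. cball d 1"] by auto
  qed
  ultimately show ?thesis
    unfolding translate using add_subgroup_lattice discrete_lattice by (intro exI[of _ lattice] conjI allI) simp_all
qed

end
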